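(* In each of the following cases every convex plane bicycle $(n,k)$-gon is regular: 1) $n$ arbitrary and $k=2$; 2) $n$ odd and $k=3$; 3) $k$ arbitrary and $n=2k+1$; 4) $k$ arbitrary and $n=3k$.
   Context: Let $P$ be an $n$-gon in the plane with consecutive vertices $V_1,V_2,\dots,V_n$, indices understood cyclically modulo $n$. A $k$-diagonal is a segment $V_iV_{i+k}$. For integers $n,k$ with $2\le k\le n/2$, $P$ is called a bicycle $(n,k)$-gon if all its sides $V_iV_{i+1}$ have equal lengths and all its $k$-diagonals $V_iV_{i+k}$, $i=1,\dots,n$, have equal lengths. The condition $2\le k\le n/2$ is assumed in all cases. *)

theory Defs
  imports "HOL-Analysis.Analysis"
begin

text \<open>
  The Euclidean plane is the type \<^typ>\<open>complex\<close>. An \<open>n\<close>-gon is given by its vertices in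
  consecutive order; the cyclic indexing is rendered by an \<open>n\<close>-periodic family over the integers.
\<close>

definition closed_polygon :: "nat \<Rightarrow> (int \<Rightarrow> complex) \<Rightarrow> bool" where
  "closed_polygon n V \<longleftrightarrow> 3 \<le> n \<and> (\<forall>i. V (i + int n) = V i)"

definition side :: "(int \<Rightarrow> complex) \<Rightarrow> int \<Rightarrow> complex set" where
  "side V i = closed_segment (V i) (V (i + 1))"

text \<open>
  A closed polygonal curve is simple iff its sides are nondegenerate and the half-open sides,
  each without its final endpoint, are pairwise disjoint. In particular the \<open>n\<close> vertices are
  distinct.
\<close>

definition simple_polygon :: "nat \<Rightarrow> (int \<Rightarrow> complex) \<Rightarrow> bool" where
  "simple_polygon n V \<longleftrightarrow>
     closed_polygon n V \<and>
     (\<forall>i. V i \<noteq> V (i + 1)) \<and>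
     (\<forall>i\<in>{0..<int n}. \<forall>j\<in>{0..<int n}. i \<noteq> j \<longrightarrow>
        (side V i - {V (i + 1)}) \<inter> (side V j - {V (j + 1)}) = {})"

text \<open>
  A convex polygon is a simple polygon that bounds a convex region; this region is then the convex
  hull of the vertices. Straight angles at vertices are not excluded.
\<close>

definition convex_polygon :: "nat \<Rightarrow> (int \<Rightarrow> complex) \<Rightarrow> bool" where
  "convex_polygon n V \<longleftrightarrow>
     simple_polygon n V \<and> frontier (convex hull (range V)) = (\<Union>i. side V i)"

definition equal_diagonals :: "nat \<Rightarrow> (int \<Rightarrow> complex) \<Rightarrow> bool" where
  "equal_diagonals k V \<longleftrightarrow> (\<exists>d. \<forall>i. dist (V i) (V (i + int k)) = d)"

definition equilateral :: "(int \<Rightarrow> complex) \<Rightarrow> bool" where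
  "equilateral V \<longleftrightarrow> (\<exists>s. \<forall>i. dist (V i) (V (i + 1)) = s)"

definition bicycle_polygon :: "nat \<Rightarrow> nat \<Rightarrow> (int \<Rightarrow> complex) \<Rightarrow> bool" where
  "bicycle_polygon n k V \<longleftrightarrow>
     2 \<le> k \<and> 2 * k \<le> n \<and> closed_polygon n V \<and> equilateral V \<and> equal_diagonals k V"

text \<open>
  The unoriented angle at a vertex, with values between 0 and \<open>pi\<close>; for a convex polygon it is the
  interior angle.
\<close>

definition vertex_angle :: "(int \<Rightarrow> complex) \<Rightarrow> int \<Rightarrow> real" where
  "vertex_angle V i =
     arccos (((V (i - 1) - V i) \<bullet> (V (i + 1) - V i)) /
             (norm (V (i - 1) - V i) * norm (V (i + 1) - V i)))"

definition equiangular :: "(int \<Rightarrow> complex) \<Rightarrow> bool" where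
  "equiangular V \<longleftrightarrow> (\<exists>\<alpha>. \<forall>i. vertex_angle V i = \<alpha>)"

text \<open>Including convexity rules out the regular star polygons.\<close>

definition regular_polygon :: "nat \<Rightarrow> (int \<Rightarrow> complex) \<Rightarrow> bool" where
  "regular_polygon n V \<longleftrightarrow> convex_polygon n V \<and> equilateral V \<and> equiangular V"

end

theory Submission
  imports Defs
begin

text \<open>
  Since the sides are equal, the angle at \<open>V (i + 1)\<close> is determined by the short diagonal
  \<open>V i V (i + 2)\<close>, so it suffices that all short diagonals are equal. For \<open>k = 2\<close> this is the
  hypothesis. For \<open>k = 3\<close>, the reflection swapping \<open>V (i + 1)\<close> and \<open>V (i + 3)\<close> fixes \<open>V (i + 2)\<close>
  and, by convexity, swaps \<open>V i\<close> and \<open>V (i + 4)\<close>; so the short diagonals from \<open>i\<close> and \<open>i + 2\<close> are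
  equal, and \<open>n\<close> is odd. For \<open>n = 2k + 1\<close> and \<open>n = 3k\<close> the \<open>2k\<close>-diagonals are also all equal,
  so all triangles \<open>V i, V (i + k), V (i + 2k)\<close> are congruent, with the same orientation by convexity,
  and each \<open>k\<close>-diagonal is carried to the next by one and the same rotation. For \<open>n = 2k + 1\<close> a short
  diagonal is the sum of four successive \<open>k\<close>-diagonals, hence of constant length. For \<open>n = 3k\<close> the
  triangles are equilateral; the three side vectors at \<open>i\<close>, \<open>i + k\<close>, \<open>i + 2k\<close> have equal length and
  form an equilateral triangle themselves, so either they coincide, which convexity excludes, or they
  sum to zero. Then all triangles have the same centre and the polygon is inscribed in a circle.
\<close>

section \<open>Cross products in the plane\<close>

text \<open>The determinant of two vectors, positive for a left turn. This form pairs it with the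
  inner product, the real part of \<open>cnj a * b\<close>.\<close>

definition cross2 :: "complex \<Rightarrow> complex \<Rightarrow> real" where
  "cross2 a b = Im (cnj a * b)"

lemma cross2_alt: "cross2 a b = Re a * Im b - Im a * Re b"
  by (simp add: cross2_def)

lemma cross2_cnj: "cross2 (cnj a) (cnj b) = - cross2 a b"
  by (simp add: cross2_alt)

lemma cross2_polar: "cross2 a b = cmod a * cmod b * sin (Arg b - Arg a)"
proof -
  have "cross2 (rcis r s) (rcis t u) = r * t * sin (u - s)" for r s t u
    by (simp add: cross2_alt sin_diff algebra_simps)
  then show ?thesis
    by (metis rcis_cmod_Arg)
qed

text \<open>Expansion of an inner product in the orthogonal basis formed by \<open>e\<close> and its
  quarter turn, multiplied out to avoid division.\<close>

lemma cross2_inner_expand: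
  "(norm e)\<^sup>2 * (a \<bullet> w) = (a \<bullet> e) * (e \<bullet> w) + cross2 e a * cross2 e w"
  by (simp add: cross2_alt inner_complex_def cmod_power2) algebra

text \<open>Consecutive arguments in \<open>[0, pi]\<close> with nonnegative cross product can only drop by jumping
  from \<open>pi\<close> to \<open>0\<close>, and then the segment between them passes through the origin.\<close>

lemma cross2_nonneg_chain:
  fixes W :: "int \<Rightarrow> complex"
  assumes upper: "\<And>m. p \<le> m \<Longrightarrow> m \<le> q \<Longrightarrow> 0 \<le> Im (W m)"
    and step: "\<And>m. p \<le> m \<Longrightarrow> m < q \<Longrightarrow> 0 \<le> cross2 (W m) (W (m + 1))"
    and seg: "\<And>m. p \<le> m \<Longrightarrow> m < q \<Longrightarrow> 0 \<notin> closed_segment (W m) (W (m + 1))"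
    and jl: "p \<le> j" "j \<le> l" "l \<le> q"
  shows "0 \<le> cross2 (W j) (W l)"
proof -
  have rng: "0 \<le> Arg (W m) \<and> Arg (W m) \<le> pi" if "p \<le> m" "m \<le> q" for m
    using upper[OF that] by (simp add: Arg_less_0 Arg_le_pi)
  have mono1: "Arg (W m) \<le> Arg (W (m + 1))" if m: "p \<le> m" "m < q" for m
  proof (rule ccontr)
    assume less: "\<not> Arg (W m) \<le> Arg (W (m + 1))"
    have nz: "W m \<noteq> 0" "W (m + 1) \<noteq> 0"
      using seg[OF m] by auto
    have "0 \<le> sin (Arg (W (m + 1)) - Arg (W m))"
      using step[OF m] nz unfolding cross2_polar
      by (metis mult_pos_pos not_less zero_less_norm_iff mult_pos_neg)
    moreover have "sin (Arg (W m) - Arg (W (m + 1))) > 0"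
      if "Arg (W m) - Arg (W (m + 1)) < pi"
      using less that by (intro sin_gt_zero) auto
    ultimately have "Arg (W m) - Arg (W (m + 1)) \<ge> pi"
      by (metis minus_diff_eq neg_0_le_iff_le not_less sin_minus)
    then have "Arg (W m) = pi" "Arg (W (m + 1)) = 0"
      using rng[of m] rng[of "m + 1"] m by auto
    then have W: "Re (W m) < 0" "Im (W m) = 0" "Re (W (m + 1)) \<ge> 0" "Im (W (m + 1)) = 0"
      by (auto simp: Arg_eq_pi Arg_eq_0 complex_is_Real_iff)
    \<comment> \<open>The parameter at which the real part vanishes along the segment; both
      imaginary parts are zero.\<close>
    define u where "u = Re (W m) / (Re (W m) - Re (W (m + 1)))"
    have "0 = (1 - u) *\<^sub>R W m + u *\<^sub>R W (m + 1)" "0 \<le> u" "u \<le> 1"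
      using W by (auto simp: u_def complex_eq_iff field_simps)
    then show False
      using seg[OF m] by (auto simp: in_segment)
  qed
  have "l \<le> q \<longrightarrow> Arg (W j) \<le> Arg (W l)"
    using jl(2)
  proof (induction l rule: int_ge_induct)
    case (step i)
    then show ?case
      using mono1[of i] jl(1) by fastforce
  qed auto
  then have "0 \<le> sin (Arg (W l) - Arg (W j))"
    using rng[of j] rng[of l] jl by (intro sin_ge_zero) auto
  then show ?thesis
    by (simp add: cross2_polar)
qed

section \<open>Convex polygons\<close>

lemma closed_polygon_mult:
  assumes "closed_polygon n V"
  shows "V (i + int n * z) = V i"
proof (induction z rule: int_induct[where k = 0])
  case (step1 z)
  then show ?case
    using assms unfolding closed_polygon_def
    by (metis add.assoc distrib_left mult.right_neutral)
next
  case (step2 z)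
  have "V (i + int n * (z - 1)) = V (i + int n * (z - 1) + int n)"
    using assms unfolding closed_polygon_def by metis
  then show ?case
    using step2 by (simp add: algebra_simps)
qed simp

lemma closed_polygon_mod:
  assumes "closed_polygon n V"
  shows "V (i mod int n) = V i"
  using closed_polygon_mult[OF assms, of "i mod int n" "i div int n"] by simp

lemma side_mod:
  assumes "closed_polygon n V"
  shows "V (i mod int n + 1) = V (i + 1)" "side V (i mod int n) = side V i"
proof -
  show *: "V (i mod int n + 1) = V (i + 1)"
    by (metis assms closed_polygon_mod mod_add_left_eq)
  show "side V (i mod int n) = side V i"
    unfolding side_def * closed_polygon_mod[OF assms] ..
qed

text \<open>Each vertex belongs to the half-open side that starts at it, and half-open sides are
  disjoint; a side owns its start, and its final endpoint belongs to the next side.\<close>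

lemma vertex_in_side:
  assumes V: "simple_polygon n V" and mem: "V j \<in> side V i"
  shows "j mod int n = i mod int n \<or> j mod int n = (i + 1) mod int n"
proof -
  have cl: "closed_polygon n V" and ne: "\<And>i. V i \<noteq> V (i + 1)"
    using V by (auto simp: simple_polygon_def)
  then have n: "0 < int n"
    by (simp add: closed_polygon_def)
  have disj: "a mod int n = b mod int n"
    if "x \<in> side V a - {V (a + 1)}" "x \<in> side V b - {V (b + 1)}" for a b x
  proof (rule ccontr)
    assume "a mod int n \<noteq> b mod int n"
    moreover have "a mod int n \<in> {0..<int n}" "b mod int n \<in> {0..<int n}"
      using n by auto
    ultimately have "(side V (a mod int n) - {V (a mod int n + 1)}) \<inter>
        (side V (b mod int n) - {V (b mod int n + 1)}) = {}"
      using V unfolding simple_polygon_def by blast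
    then show False
      using that unfolding side_mod[OF cl] by blast
  qed
  have own: "V i \<in> side V i - {V (i + 1)}" for i
    using ne by (simp add: side_def)
  show ?thesis
    using disj[of "V j" j i] disj[of "V j" j "i + 1"] own mem
    by (metis Diff_iff empty_iff insert_iff)
qed

lemma simple_polygon_vertices_distinct:
  assumes V: "simple_polygon n V" and "0 < k" "k < int n"
  shows "V (i + k) \<noteq> V i"
proof
  assume eq: "V (i + k) = V i"
  have "V (i + k) \<in> side V (i + k)" "V (i - 1 + 1) \<in> side V (i - 1)"
    by (simp_all add: side_def)
  then have "V i \<in> side V (i + k)" "V (i + k) \<in> side V (i - 1)"
    using eq by simp_all
  from vertex_in_side[OF V this(1)] vertex_in_side[OF V this(2)]
  have "int n dvd k \<or> int n dvd (k + 1)" "int n dvd k \<or> int n dvd k + 1"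
    by (auto simp: mod_eq_dvd_iff dvd_diff_commute algebra_simps)
  then have dvd: "int n dvd k + 1"
    using assms by (auto dest: zdvd_imp_le)
  \<comment> \<open>Only the cyclic predecessor could coincide with \<open>V i\<close>, and then the
    side between them would be degenerate.\<close>
  have "k + 1 = int n"
    using zdvd_imp_le[OF dvd] assms by simp
  then have "V (i + k + 1) = V i"
    using V by (simp add: simple_polygon_def closed_polygon_def add.assoc)
  then show False
    using eq V by (metis simple_polygon_def)
qed

section \<open>Supporting lines and common orientation\<close>

text \<open>A convex set with empty interior lies in a hyperplane, whose normal supports it at every
  point. Covering this case means that the hull of the vertices need not be shown full-dimensional
  first.\<close>

lemma supporting_hyperplane_frontier:
  fixes S :: "'a::euclidean_space set"
  assumes S: "convex S" and z: "z \<in> frontier S"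
  obtains a where "a \<noteq> 0" "\<And>y. y \<in> S \<Longrightarrow> a \<bullet> z \<le> a \<bullet> y"
proof (cases "interior S = {}")
  case True
  then obtain a b where a: "a \<noteq> 0" "S \<subseteq> {x. a \<bullet> x = b}"
    using empty_interior_subset_hyperplane[OF S] by metis
  have "closure S \<subseteq> {x. a \<bullet> x = b}"
    by (rule closure_minimal[OF a(2)]) (rule closed_hyperplane)
  then have "a \<bullet> z = b"
    using z by (auto simp: frontier_def)
  then show ?thesis
    using a by (intro that[of a]) auto
next
  case False
  then have "z \<in> closure S" "z \<notin> rel_interior S"
    using z by (auto simp: frontier_def rel_interior_nonempty_interior)
  from supporting_hyperplane_relative_frontier[OF S this] show ?thesis
    by (metis closure_subset subsetD that)
qed

text \<open>A linear functional that is minimal at the midpoint of a side is constant on that side,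
  so a supporting line there contains the side. The sign may still depend on
  \<open>i\<close>.\<close>

lemma convex_polygon_side_supporting:
  assumes V: "convex_polygon n V"
  obtains \<sigma> :: real where "\<sigma> = 1 \<or> \<sigma> = -1"
    "\<And>j. 0 \<le> \<sigma> * cross2 (V (i + 1) - V i) (V j - V i)"
proof -
  define e where "e = V (i + 1) - V i"
  have e: "e \<noteq> 0"
    using V by (auto simp: e_def convex_polygon_def simple_polygon_def) (metis)
  have "midpoint (V i) (V (i + 1)) \<in> side V i"
    by (simp add: side_def midpoint_in_closed_segment)
  then have "midpoint (V i) (V (i + 1)) \<in> frontier (convex hull (range V))"
    using V by (auto simp: convex_polygon_def)
  then obtain a where a: "a \<noteq> 0"
    and le: "\<And>y. y \<in> convex hull (range V) \<Longrightarrow> a \<bullet> midpoint (V i) (V (i + 1)) \<le> a \<bullet> y"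
    by (rule supporting_hyperplane_frontier[rotated]) (auto simp: convex_convex_hull)
  have le': "a \<bullet> midpoint (V i) (V (i + 1)) \<le> a \<bullet> V j" for j
    by (rule le) (auto intro: hull_inc)
  have mid: "a \<bullet> midpoint (V i) (V (i + 1)) = (a \<bullet> V i + a \<bullet> V (i + 1)) / 2"
    by (simp add: midpoint_def inner_add_right)
  have ae: "a \<bullet> e = 0" and nonneg: "0 \<le> a \<bullet> (V j - V i)" for j
    using le'[of i] le'[of "i + 1"] le'[of j] mid by (auto simp: e_def inner_diff_right)
  have "(norm e)\<^sup>2 * (norm a)\<^sup>2 = (cross2 e a)\<^sup>2"
    using cross2_inner_expand[of e a a] ae
    unfolding power2_norm_eq_inner[of a] by (simp add: power2_eq_square)
  then have c: "cross2 e a \<noteq> 0"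
    using a e by auto
  \<comment> \<open>As \<open>a\<close> is orthogonal to \<open>e\<close>, only the cross product
    term of the expansion remains.\<close>
  have side: "0 \<le> cross2 e a * cross2 e (V j - V i)" for j
    using cross2_inner_expand[of e a "V j - V i"] ae nonneg[of j]
    by (metis add_0 mult_nonneg_nonneg mult_zero_left zero_le_power2)
  have "0 \<le> sgn (cross2 e a) * cross2 e (V j - V i)" for j
    using side[of j] c by (auto simp: sgn_if zero_le_mult_iff)
  moreover have "sgn (cross2 e a) = 1 \<or> sgn (cross2 e a) = -1"
    using c by (auto simp: sgn_if)
  ultimately show ?thesis
    using that e_def by blast
qed

text \<open>At a proper corner the two supporting sides determine the same orientation; at a straight
  angle the two sides span the same supporting line.\<close>

lemma convex_polygon_sides_oriented:
  assumes V: "convex_polygon n V"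
  obtains \<sigma> :: real where "\<sigma> = 1 \<or> \<sigma> = -1"
    "\<And>i j. 0 \<le> \<sigma> * cross2 (V (i + 1) - V i) (V j - V i)"
proof -
  have simple: "simple_polygon n V" and cl: "closed_polygon n V"
    using V by (auto simp: convex_polygon_def simple_polygon_def)
  then have n: "3 \<le> int n"
    by (simp add: closed_polygon_def)
  obtain \<sigma> :: real where \<sigma>: "\<sigma> = 1 \<or> \<sigma> = -1"
    "\<And>j. 0 \<le> \<sigma> * cross2 (V (0 + 1) - V 0) (V j - V 0)"
    using convex_polygon_side_supporting[OF V, of 0] by blast
  have next_side: "0 \<le> \<sigma> * cross2 (V (i + 1 + 1) - V (i + 1)) (V j - V (i + 1))"
    if i: "\<And>j. 0 \<le> \<sigma> * cross2 (V (i + 1) - V i) (V j - V i)" for i j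
  proof -
    define e f where "e = V (i + 1) - V i" and "f = V (i + 1 + 1) - V (i + 1)"
    have "V i \<noteq> V (i + 1)" "V (i + 1) \<noteq> V (i + 1 + 1)"
      using simple unfolding simple_polygon_def by blast+
    then have ne: "e \<noteq> 0" "f \<noteq> 0"
      unfolding e_def f_def right_minus_eq by metis+
    have ef: "cross2 e (V (i + 1 + 1) - V i) = cross2 e f"
      "cross2 f (V i - V (i + 1)) = cross2 e f"
      by (simp_all add: e_def f_def cross2_alt algebra_simps)
    show ?thesis
    proof (cases "cross2 e f = 0")
      case False
      obtain \<tau> :: real where \<tau>: "\<tau> = 1 \<or> \<tau> = -1"
        "\<And>j. 0 \<le> \<tau> * cross2 (V (i + 1 + 1) - V (i + 1)) (V j - V (i + 1))"
        using convex_polygon_side_supporting[OF V, of "i + 1"] by blast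
      have "0 \<le> \<sigma> * cross2 e f" "0 \<le> \<tau> * cross2 e f"
        using i[of "i + 1 + 1"] \<tau>(2)[of i] ef by (simp_all add: e_def f_def)
      then have "\<sigma> = \<tau>"
        using False \<sigma>(1) \<tau>(1) by auto
      then show ?thesis
        using \<tau>(2) by simp
    next
      case True
      define t where "t = (e \<bullet> f) / (norm e)\<^sup>2"
      have "(norm e)\<^sup>2 * Re f = (e \<bullet> f) * Re e" "(norm e)\<^sup>2 * Im f = (e \<bullet> f) * Im e"
        using True by (simp_all add: cross2_alt cmod_power2 inner_complex_def) algebra+
      then have f: "f = t *\<^sub>R e"
        using ne by (simp add: t_def complex_eq_iff field_simps)
      \<comment> \<open>A negative ratio would fold the second side back onto the first, so that the
        far end of one of them lies on the other.\<close>
      have "0 \<le> t"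
      proof (rule ccontr)
        assume t: "\<not> 0 \<le> t"
        have "V i \<in> side V (i + 1)" if "t \<le> -1"
        proof -
          have e: "e = (1 / t) *\<^sub>R f"
            using f t by simp
          have "V i = (1 - (- 1 / t)) *\<^sub>R V (i + 1) + (- 1 / t) *\<^sub>R V (i + 1 + 1)"
            using e by (simp add: e_def f_def algebra_simps)
          then show ?thesis
            using t that unfolding side_def in_segment
            by (intro exI[of _ "- 1 / t"]) (auto simp: field_simps)
        qed
        moreover have "V (i + 1 + 1) \<in> side V i" if "-1 \<le> t"
        proof -
          have "V (i + 1 + 1) = (1 - (1 + t)) *\<^sub>R V i + (1 + t) *\<^sub>R V (i + 1)"
            using f by (simp add: e_def f_def complex_eq_iff field_simps)
          then show ?thesis
            using t that unfolding side_def in_segment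
            by (intro exI[of _ "1 + t"]) auto
        qed
        ultimately have "i mod int n = (i + 1) mod int n \<or> i mod int n = (i + 1 + 1) mod int n
          \<or> (i + 1 + 1) mod int n = i mod int n \<or> (i + 1 + 1) mod int n = (i + 1) mod int n"
          using vertex_in_side[OF simple] by (meson linear)
        then have "int n dvd 1 \<or> int n dvd 2"
          by (auto simp: mod_eq_dvd_iff dvd_diff_commute)
        then show False
          using n by (auto dest: zdvd_imp_le)
      qed
      \<comment> \<open>Moving the base point along \<open>e\<close> does not change the cross
        product with \<open>e\<close>.\<close>
      moreover have "cross2 f (V j - V (i + 1)) = t * cross2 e (V j - V i)"
        unfolding f by (simp add: e_def cross2_alt algebra_simps)
      ultimately show ?thesis
        using i[of j] by (metis e_def f_def mult.left_commute mult_nonneg_nonneg)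
    qed
  qed
  have "\<forall>j. 0 \<le> \<sigma> * cross2 (V (i + 1) - V i) (V j - V i)" if "0 \<le> i" for i
    using that
  proof (induction i rule: int_ge_induct)
    case base
    show ?case using \<sigma>(2) by blast
  next
    case (step i)
    then show ?case using next_side by blast
  qed
  then have "0 \<le> \<sigma> * cross2 (V (i mod int n + 1) - V (i mod int n)) (V j - V (i mod int n))"
    for i j
    using n by simp
  then have "0 \<le> \<sigma> * cross2 (V (i + 1) - V i) (V j - V i)" for i j
    by (metis closed_polygon_mod[OF cl] side_mod(1)[OF cl])
  then show ?thesis
    using that \<sigma>(1) by blast
qed

text \<open>Seen from \<open>V i\<close>, all vertices lie on one side of the line through the first
  side, and each further side turns in the same sense. So the arguments are monotone and any two
  vertices can be compared.\<close>

lemma convex_polygon_oriented: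
  assumes V: "convex_polygon n V"
  obtains \<sigma> :: real where "\<sigma> = 1 \<or> \<sigma> = -1"
    "\<And>i j l. i < j \<Longrightarrow> j < l \<Longrightarrow> l < i + int n \<Longrightarrow> 0 \<le> \<sigma> * cross2 (V j - V i) (V l - V j)"
proof -
  obtain \<sigma> :: real where \<sigma>: "\<sigma> = 1 \<or> \<sigma> = -1"
    "\<And>i j. 0 \<le> \<sigma> * cross2 (V (i + 1) - V i) (V j - V i)"
    using convex_polygon_sides_oriented[OF V] by blast
  have simple: "simple_polygon n V"
    using V by (simp add: convex_polygon_def)
  have "0 \<le> \<sigma> * cross2 (V j - V i) (V l - V j)" if ijl: "i < j" "j < l" "l < i + int n" for i j l
  proof -
    define u where "u = V (i + 1) - V i"
    \<comment> \<open>Multiplication by \<open>cnj u\<close> turns the first side onto the positive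
      real axis.\<close>
    define W where "W m = cnj u * (V m - V i)" for m
    have u: "u \<noteq> 0"
      using simple by (auto simp: u_def simple_polygon_def) metis
    have scale: "cross2 (cnj u * a) (cnj u * b) = (norm u)\<^sup>2 * cross2 a b" for a b
      by (simp add: cross2_alt cmod_power2) algebra
    have nonneg: "0 \<le> \<sigma> * Im (W m)" for m
      using \<sigma>(2)[of i m] by (simp add: W_def cross2_def u_def)
    have step: "0 \<le> \<sigma> * cross2 (W m) (W (m + 1))" for m
    proof -
      have "cross2 (V m - V i) (V (m + 1) - V i) = cross2 (V (m + 1) - V m) (V i - V m)"
        by (simp add: cross2_alt algebra_simps)
      then have "0 \<le> \<sigma> * cross2 (V m - V i) (V (m + 1) - V i)"
        using \<sigma>(2)[of m i] by simp
      then show ?thesis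
        unfolding W_def scale by (metis mult.left_commute mult_nonneg_nonneg zero_le_power2)
    qed
    \<comment> \<open>The range of \<open>m\<close> leaves out exactly the two sides that meet at
      \<open>V i\<close>.\<close>
    have seg: "0 \<notin> closed_segment (W m) (W (m + 1))" if m: "i + 1 \<le> m" "m < i + int n - 1" for m
    proof
      assume "0 \<in> closed_segment (W m) (W (m + 1))"
      then obtain t where t: "0 \<le> t" "t \<le> 1" "0 = (1 - t) *\<^sub>R W m + t *\<^sub>R W (m + 1)"
        by (auto simp: in_segment)
      then have "0 = cnj u * ((1 - t) *\<^sub>R V m + t *\<^sub>R V (m + 1) - V i)"
        by (simp add: W_def scaleR_conv_of_real algebra_simps)
      then have "V i \<in> side V m"
        using t u by (auto simp: side_def in_segment)
      from vertex_in_side[OF simple this] have "int n dvd m - i \<or> int n dvd m - i + 1"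
        by (auto simp: mod_eq_dvd_iff dvd_diff_commute algebra_simps)
      then show False
        using m by (auto dest: zdvd_imp_le)
    qed
    have "0 \<le> \<sigma> * cross2 (W j) (W l)"
    proof (cases "\<sigma> = 1")
      case True
      then show ?thesis
        using cross2_nonneg_chain[of "i + 1" "i + int n - 1" W j l] nonneg step seg ijl by auto
    next
      case False
      then have \<sigma>': "\<sigma> = -1"
        using \<sigma>(1) by simp
      \<comment> \<open>Conjugation reduces the negative orientation to the positive one.\<close>
      have "0 \<notin> closed_segment (cnj (W m)) (cnj (W (m + 1)))"
        if "i + 1 \<le> m" "m < i + int n - 1" for m
      proof -
        have "closed_segment (cnj (W m)) (cnj (W (m + 1))) = cnj ` closed_segment (W m) (W (m + 1))"
          by (rule closed_segment_linear_image) (simp add: bounded_linear.linear bounded_linear_cnj)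
        then show ?thesis
          using seg[OF that] by auto
      qed
      then have "0 \<le> cross2 (cnj (W j)) (cnj (W l))"
        using cross2_nonneg_chain[of "i + 1" "i + int n - 1" "\<lambda>m. cnj (W m)" j l] nonneg step ijl
        by (auto simp: \<sigma>' cross2_cnj)
      then show ?thesis
        by (simp add: \<sigma>' cross2_cnj)
    qed
    then have "0 \<le> (norm u)\<^sup>2 * (\<sigma> * cross2 (V j - V i) (V l - V i))"
      by (simp add: W_def scale mult.left_commute)
    moreover have "cross2 (V j - V i) (V l - V i) = cross2 (V j - V i) (V l - V j)"
      by (simp add: cross2_alt algebra_simps)
    ultimately show ?thesis
      using u by (simp add: zero_le_mult_iff)
  qed
  then show ?thesis
    using that \<sigma>(1) by blast
qed

section \<open>Equal short diagonals\<close>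

lemma equiangular_if_equal_short_diagonals:
  assumes "equilateral V" "equal_diagonals 2 V"
  shows "equiangular V"
proof -
  obtain s where s: "\<And>i. dist (V i) (V (i + 1)) = s"
    using assms(1) by (auto simp: equilateral_def)
  obtain d where d: "\<And>i. dist (V i) (V (i + 2)) = d"
    using assms(2) by (auto simp: equal_diagonals_def)
  have "vertex_angle V i = arccos ((s\<^sup>2 + s\<^sup>2 - d\<^sup>2) / 2 / (s * s))" for i
  proof -
    have 1: "norm (V (i - 1) - V i) = s" "norm (V (i + 1) - V i) = s"
      using s[of "i - 1"] s[of i] by (simp_all add: dist_norm norm_minus_commute)
    \<comment> \<open>The law of cosines applies to an isosceles triangle with legs \<open>s\<close>
      and base \<open>d\<close>.\<close>
    have 2: "norm ((V (i - 1) - V i) - (V (i + 1) - V i)) = d"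
      using d[of "i - 1"] by (simp add: dist_norm add.commute)
    show ?thesis
      unfolding vertex_angle_def dot_norm_neg 1 2 ..
  qed
  then show ?thesis
    by (auto simp: equiangular_def)
qed

lemma int_const_if_step:
  fixes f :: "int \<Rightarrow> 'a"
  assumes "\<And>i. f (i + 1) = f i"
  shows "f i = f 0"
proof (induction i rule: int_induct[where k = 0])
  case (step1 i)
  then show ?case by (simp add: assms)
next
  case (step2 i)
  then show ?case using assms[of "i - 1"] by simp
qed simp

text \<open>The perpendicular bisector of \<open>B C\<close> is a symmetry axis of the figure: it passes through \<open>M\<close>
  and swaps \<open>A\<close> and \<open>E\<close>.\<close>

lemma dist_eq_by_reflection:
  fixes A B M C E :: complex
  assumes "B \<noteq> C" and "dist A B = dist C E" "dist A C = dist B E" "dist B M = dist M C"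
    and \<sigma>: "\<sigma> = 1 \<or> \<sigma> = (-1::real)"
    and "0 \<le> \<sigma> * cross2 (B - A) (C - B)" "0 \<le> \<sigma> * cross2 (C - B) (E - C)"
  shows "dist A M = dist M E"
proof -
  define u a e m where "u = C - B" and "a = A - B" and "e = E - C" and "m = M - B"
  have norms: "norm a = norm e" "norm (a - u) = norm (e + u)" "norm m = norm (m - u)"
    using assms by (simp_all add: u_def a_def e_def m_def dist_norm norm_minus_commute)
  have sq: "(norm a)\<^sup>2 = (norm e)\<^sup>2" "(norm (a - u))\<^sup>2 = (norm (e + u))\<^sup>2"
    "(norm m)\<^sup>2 = (norm (m - u))\<^sup>2"
    using norms by simp_all
  have re: "Re (cnj u * e) = - Re (cnj u * a)" "Re (cnj u * (m - u)) = - Re (cnj u * m)"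
    using sq unfolding cmod_power2 by (simp_all add: power2_eq_square algebra_simps)
  have "(norm (cnj u * a))\<^sup>2 = (norm (cnj u * e))\<^sup>2"
    using norms by (simp add: norm_mult)
  then have "(Im (cnj u * a))\<^sup>2 = (Im (cnj u * e))\<^sup>2"
    unfolding cmod_power2 re power2_minus by (simp only: add_left_cancel)
  moreover have "Im (cnj u * a) = cross2 (B - A) (C - B)" "Im (cnj u * e) = cross2 (C - B) (E - C)"
    by (simp_all add: cross2_alt u_def a_def e_def algebra_simps)
  \<comment> \<open>The squares agree, and the common orientation rules out opposite signs.\<close>
  ultimately have "Im (cnj u * e) = Im (cnj u * a)"
    using assms by (auto simp: power2_eq_iff)
  moreover have "Im (cnj u * (m - u)) = Im (cnj u * m)"
    by (simp add: algebra_simps)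
  ultimately have im: "Im (cnj u * e) = Im (cnj u * a)" "Im (cnj u * (m - u)) = Im (cnj u * m)"
    by simp_all
  \<comment> \<open>In the frame along \<open>u\<close> the reflection acts on vectors by negating
    the real part. It takes \<open>a\<close>, based at \<open>B\<close>, to \<open>e\<close>, based
    at \<open>C\<close>, and likewise \<open>m\<close> to \<open>m - u\<close>.\<close>
  have "cnj u * e = - cnj (cnj u * a)" "cnj u * (m - u) = - cnj (cnj u * m)"
    by (simp_all only: complex_eq_iff re im uminus_complex.simps cnj.simps minus_minus)
  then have "cnj u * (e - (m - u)) = - cnj (cnj u * (a - m))"
    unfolding right_diff_distrib by simp
  then have "norm (cnj u * (e - (m - u))) = norm (cnj u * (a - m))"
    by (metis complex_mod_cnj norm_minus_cancel)
  then have "norm (e - (m - u)) = norm (a - m)"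
    using assms(1) by (simp add: norm_mult u_def)
  then show ?thesis
    by (simp add: u_def a_def e_def m_def dist_norm norm_minus_commute)
qed

lemma equal_short_diagonals_3:
  assumes V: "convex_polygon n V" and n: "odd n" "6 \<le> n"
    and eq: "equilateral V" "equal_diagonals 3 V"
  shows "equal_diagonals 2 V"
proof -
  have simple: "simple_polygon n V" and per: "\<And>i. V (i + int n) = V i"
    using V by (auto simp: convex_polygon_def simple_polygon_def closed_polygon_def)
  obtain s where s: "\<And>i. dist (V i) (V (i + 1)) = s"
    using eq(1) by (auto simp: equilateral_def)
  obtain d where d: "\<And>i. dist (V i) (V (i + 3)) = d"
    using eq(2) by (auto simp: equal_diagonals_def)
  obtain \<sigma> :: real where \<sigma>: "\<sigma> = 1 \<or> \<sigma> = -1"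
    "\<And>i j l. i < j \<Longrightarrow> j < l \<Longrightarrow> l < i + int n \<Longrightarrow> 0 \<le> \<sigma> * cross2 (V j - V i) (V l - V j)"
    using convex_polygon_oriented[OF V] by blast
  define D where "D i = dist (V i) (V (i + 2))" for i
  have D2: "D (i + 2) = D i" for i
  proof -
    have "dist (V i) (V (i + 2)) = dist (V (i + 2)) (V (i + 4))"
    proof (rule dist_eq_by_reflection[where B = "V (i + 1)" and C = "V (i + 3)" and \<sigma> = \<sigma>])
      show "V (i + 1) \<noteq> V (i + 3)"
        using simple_polygon_vertices_distinct[OF simple, of 2 "i + 1"] n by (simp add: add.assoc)
      show "dist (V i) (V (i + 1)) = dist (V (i + 3)) (V (i + 4))"
        using s[of i] s[of "i + 3"] by (simp add: add.assoc)
      show "dist (V i) (V (i + 3)) = dist (V (i + 1)) (V (i + 4))"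
        using d[of i] d[of "i + 1"] by (simp add: add.assoc)
      show "dist (V (i + 1)) (V (i + 2)) = dist (V (i + 2)) (V (i + 3))"
        using s[of "i + 1"] s[of "i + 2"] by (simp add: add.assoc)
    qed (use \<sigma> n in auto)
    then show ?thesis
      by (simp add: D_def add.assoc)
  qed
  have Dj: "D (i + 2 * int j) = D i" for i j
  proof (induction j)
    case (Suc j)
    then show ?case
      using D2[of "i + 2 * int j"] by (simp add: algebra_simps)
  qed simp
  obtain m where m: "n = 2 * m + 1"
    using n(1) by (auto elim: oddE)
  have "D (i + 1) = D i" for i
  proof -
    \<comment> \<open>As \<open>n\<close> is odd, steps of two indices lead from
      \<open>i + 1\<close> to \<open>i + n\<close>.\<close>
    have "D (i + 1) = D (i + 1 + 2 * int m)"
      by (simp add: Dj)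
    also have "\<dots> = D (i + int n)"
      by (simp add: m algebra_simps)
    also have "\<dots> = D i"
      using per[of i] per[of "i + 2"] by (simp add: D_def algebra_simps)
    finally show ?thesis .
  qed
  from int_const_if_step[of D, OF this] show ?thesis
    unfolding equal_diagonals_def D_def by auto
qed

section \<open>The rotation carrying each long diagonal to the next\<close>

text \<open>The quotient of \<open>b\<close> by \<open>a\<close> has modulus one. The third side of
  the triangle fixes its real part, the cosine \<open>c\<close> of the turning angle, and the
  orientation fixes the sign of its imaginary part.\<close>

lemma eq_mult_if_norms_eq:
  fixes a b :: complex
  assumes "norm a = d" "norm b = d" "norm (a + b) = s" "d \<noteq> 0"
    and "\<sigma> = 1 \<or> \<sigma> = -1" "0 \<le> \<sigma> * cross2 a b"
  defines "c \<equiv> s\<^sup>2 / (2 * d\<^sup>2) - 1"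
  shows "b = Complex c (\<sigma> * sqrt (1 - c\<^sup>2)) * a"
proof -
  define z where "z = b / a"
  have a: "a \<noteq> 0" and b: "b = z * a"
    using assms by (auto simp: z_def)
  have z1: "norm z = 1"
    using assms by (simp add: z_def norm_divide)
  then have z1': "(Re z)\<^sup>2 + (Im z)\<^sup>2 = 1"
    by (metis cmod_power2 one_power2)
  have "a + b = (1 + z) * a"
    by (simp add: b algebra_simps)
  then have "s\<^sup>2 = ((1 + Re z)\<^sup>2 + (Im z)\<^sup>2) * d\<^sup>2"
    using assms(1,3) by (metis cmod_power2 norm_mult power_mult_distrib plus_complex.simps one_complex.simps add_0)
  then have "s\<^sup>2 = (2 + 2 * Re z) * d\<^sup>2"
    using z1' by (simp add: power2_sum)
  then have re: "Re z = c"
    using assms(4) by (simp add: c_def field_simps)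
  have "cross2 a b = (norm a)\<^sup>2 * Im z"
    by (simp add: b cross2_alt cmod_power2) algebra
  then have "0 \<le> \<sigma> * Im z"
    using assms(5,6) a by (auto simp: zero_le_mult_iff mult_le_0_iff)
  moreover have "(\<sigma> * Im z)\<^sup>2 = 1 - c\<^sup>2"
    using z1' re assms(5) by (auto simp: power_mult_distrib)
  ultimately have "\<sigma> * Im z = sqrt (1 - c\<^sup>2)"
    by (metis real_sqrt_unique)
  then have "Im z = \<sigma> * sqrt (1 - c\<^sup>2)"
    using assms(5) by auto
  then show ?thesis
    using re b by (metis complex_surj)
qed

lemma diagonal_rotation:
  assumes V: "convex_polygon n V" and k: "0 < k" "2 * k < n"
    and eq: "equal_diagonals k V" "equal_diagonals (2 * k) V"
  obtains Z where "\<And>i. V (i + 2 * int k) - V (i + int k) = Z * (V (i + int k) - V i)"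
proof -
  have simple: "simple_polygon n V"
    using V by (simp add: convex_polygon_def)
  obtain d where d: "\<And>i. dist (V i) (V (i + int k)) = d"
    using eq(1) by (auto simp: equal_diagonals_def)
  obtain s where s: "\<And>i. dist (V i) (V (i + 2 * int k)) = s"
    using eq(2) by (auto simp: equal_diagonals_def)
  obtain \<sigma> :: real where \<sigma>: "\<sigma> = 1 \<or> \<sigma> = -1"
    "\<And>i j l. i < j \<Longrightarrow> j < l \<Longrightarrow> l < i + int n \<Longrightarrow> 0 \<le> \<sigma> * cross2 (V j - V i) (V l - V j)"
    using convex_polygon_oriented[OF V] by blast
  have "d \<noteq> 0"
    using simple_polygon_vertices_distinct[OF simple, of "int k" 0] d[of 0] k by auto
  then have "V (i + 2 * int k) - V (i + int k) =
      Complex (s\<^sup>2 / (2 * d\<^sup>2) - 1) (\<sigma> * sqrt (1 - (s\<^sup>2 / (2 * d\<^sup>2) - 1)\<^sup>2)) * (V (i + int k) - V i)"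
    for i
    using d[of i] d[of "i + int k"] s[of i] \<sigma>(1) \<sigma>(2)[of i "i + int k" "i + 2 * int k"] k
    by (intro eq_mult_if_norms_eq) (auto simp: dist_norm norm_minus_commute algebra_simps)
  then show ?thesis
    using that by blast
qed

lemma equal_short_diagonals_Suc_double:
  assumes V: "convex_polygon n V" and k: "0 < k" "n = 2 * k + 1"
    and eq: "equilateral V" "equal_diagonals k V"
  shows "equal_diagonals 2 V"
proof -
  have per: "\<And>i. V (i + int n) = V i"
    using V by (auto simp: convex_polygon_def simple_polygon_def closed_polygon_def)
  obtain s where s: "\<And>i. dist (V i) (V (i + 1)) = s"
    using eq(1) by (auto simp: equilateral_def)
  obtain d where d: "\<And>i. dist (V i) (V (i + int k)) = d"
    using eq(2) by (auto simp: equal_diagonals_def)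
  \<comment> \<open>Since \<open>2 * k = n - 1\<close>, this diagonal is a side.\<close>
  have "dist (V i) (V (i + int (2 * k))) = s" for i
    using s[of "i + 2 * int k"] per[of i] by (simp add: k dist_commute algebra_simps)
  then have "equal_diagonals (2 * k) V"
    by (auto simp: equal_diagonals_def)
  then obtain Z where Z: "\<And>i. V (i + 2 * int k) - V (i + int k) = Z * (V (i + int k) - V i)"
    using diagonal_rotation[OF V _ _ eq(2)] k by auto
  have "dist (V i) (V (i + 2)) = norm (1 + Z + Z\<^sup>2 + Z ^ 3) * d" for i
  proof -
    define j where "j = i + 2"
    define a where "a = V (j + int k) - V j"
    \<comment> \<open>Four steps of \<open>k\<close> advance the index by \<open>2 * n - 2\<close>,
      hence the start at \<open>j = i + 2\<close>.\<close>
    have "V (j + 4 * int k) = V (i + int n + int n)"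
      by (simp add: j_def k algebra_simps)
    then have "V (j + 4 * int k) = V i"
      by (simp only: per)
    moreover have 1: "V (j + 2 * int k) - V (j + int k) = Z * a"
      using Z[of j] by (simp add: a_def)
    moreover have 2: "V (j + 3 * int k) - V (j + 2 * int k) = Z * (Z * a)"
      using Z[of "j + int k"] unfolding 1[symmetric] by (simp add: algebra_simps)
    moreover have "V (j + 4 * int k) - V (j + 3 * int k) = Z * (Z * (Z * a))"
      using Z[of "j + 2 * int k"] unfolding 2[symmetric] by (simp add: algebra_simps)
    moreover have "V i - V j = (V (j + int k) - V j) + (V (j + 2 * int k) - V (j + int k)) +
        (V (j + 3 * int k) - V (j + 2 * int k)) + (V i - V (j + 3 * int k))"
      by simp
    ultimately have "V i - V j = a + Z * a + Z * (Z * a) + Z * (Z * (Z * a))"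
      by (simp only: a_def)
    then have "V i - V j = (1 + Z + Z\<^sup>2 + Z ^ 3) * a"
      by (simp add: algebra_simps power2_eq_square power3_eq_cube)
    moreover have "norm a = d"
      using d[of j] by (simp add: a_def dist_norm norm_minus_commute)
    ultimately show ?thesis
      by (simp add: dist_norm norm_mult j_def)
  qed
  then show ?thesis
    by (auto simp: equal_diagonals_def)
qed

section \<open>Inscribed equilateral triangles\<close>

lemma primitive_cube_root:
  fixes Z :: complex
  assumes "Z\<^sup>2 + Z + 1 = 0"
  shows "Re Z = - 1 / 2" "Im Z \<noteq> 0"
proof -
  have 1: "(Re Z)\<^sup>2 - (Im Z)\<^sup>2 + Re Z + 1 = 0" "2 * Re Z * Im Z + Im Z = 0"
    using arg_cong[OF assms, of Re] arg_cong[OF assms, of Im]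
    by (simp_all add: power2_eq_square algebra_simps)
  show "Im Z \<noteq> 0"
  proof
    assume "Im Z = 0"
    then have "(Re Z + 1 / 2)\<^sup>2 + 3 / 4 = 0"
      using 1(1) by (simp add: power2_eq_square algebra_simps)
    then show False
      using zero_le_power2[of "Re Z + 1 / 2"] by linarith
  qed
  moreover have "(2 * Re Z + 1) * Im Z = 0"
    using 1(2) by (simp add: algebra_simps)
  ultimately show "Re Z = - 1 / 2"
    by simp
qed

text \<open>An equilateral triangle inscribed in a circle around the origin is centred there, so two of
  its vertex vectors determine the third.\<close>

lemma equilateral_triangle_centre:
  fixes a g Z :: complex
  assumes Z: "Z\<^sup>2 + Z + 1 = 0" and "norm (a + g) = norm a" "norm (a + g + Z * g) = norm a"
    and g: "g \<noteq> 0"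
  shows "3 * a + 2 * g + Z * g = 0"
proof -
  define h where "h = - (2 + Z) * g"
  define m where "m = 3 * a + 2 * g + Z * g"
  have Z2: "Z * Z = - Z - 1"
    using Z unfolding power2_eq_square by algebra
  \<comment> \<open>\<open>m\<close> is the sum of the three vertex vectors, and \<open>h\<close>
    runs from it to three times the first vertex. As \<open>- Z - 1\<close> is the square of
    \<open>Z\<close>, the other vertices arise by rotating \<open>h\<close>.\<close>
  have abc: "m + h = 3 * a" "m + Z * h = 3 * (a + g)" "m + (- Z - 1) * h = 3 * (a + g + Z * g)"
    by (simp_all add: m_def h_def algebra_simps Z2 flip: mult.assoc)
  have Zr: "Re Z = - 1 / 2" "Im Z \<noteq> 0"
    by (rule primitive_cube_root[OF Z])+
  have "Re (Z * Z) = Re (- Z - 1)"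
    using Z2 by simp
  then have Zi: "(Im Z)\<^sup>2 = 3 / 4"
    using Zr by (simp add: power2_eq_square)
  have nz: "Z \<noteq> - 2"
    using Zr by auto
  define w where "w = cnj m * h"
  have nsq: "(norm (m + z))\<^sup>2 = (norm m)\<^sup>2 + (norm z)\<^sup>2 + 2 * Re (cnj m * z)" for z
    unfolding cmod_power2 by (simp add: power2_eq_square algebra_simps)
  have nz1: "(norm Z)\<^sup>2 = 1" "(norm (- Z - 1))\<^sup>2 = 1"
    using Zr Zi unfolding cmod_power2 by (simp_all add: power2_eq_square)
  have "(norm (m + Z * h))\<^sup>2 = (norm (m + h))\<^sup>2" "(norm (m + (- Z - 1) * h))\<^sup>2 = (norm (m + h))\<^sup>2"
    unfolding abc using assms(2,3) by (simp_all add: norm_mult del: distrib_left_numeral)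
  then have "Re (cnj m * (Z * h)) = Re w" "Re (cnj m * ((- Z - 1) * h)) = Re w"
    unfolding nsq norm_mult power_mult_distrib nz1 w_def by simp_all
  moreover have "cnj m * (Z * h) = w * Z" "cnj m * ((- Z - 1) * h) = w * (- Z - 1)"
    by (simp_all add: w_def mult_ac)
  \<comment> \<open>The numbers \<open>w\<close>, \<open>w * Z\<close> and
    \<open>w * (- Z - 1)\<close> sum to zero and have equal real parts, so these vanish; since
    \<open>Z\<close> is not real, \<open>w\<close> is zero.\<close>
  ultimately have "Re (w * Z) = Re w" "Re (w * (- Z - 1)) = Re w"
    by simp_all
  then have "Re w = 0" "Im w * Im Z = 0"
    using Zr by (simp_all add: algebra_simps)
  then have "w = 0"
    using Zr by (simp add: complex_eq_iff)
  then show ?thesis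
    using g nz unfolding m_def[symmetric] by (simp add: w_def h_def)
qed

text \<open>For \<open>x \<noteq> z\<close> on the circle at equal distances from \<open>y\<close>, reflection in the line through the
  centre and \<open>y\<close> swaps \<open>x\<close> and \<open>z\<close>.\<close>

lemma dist_on_circle:
  fixes x y z :: complex
  assumes "norm x = r" "norm y = r" "norm z = r" "dist x y = s" "dist y z = s" "x \<noteq> z"
  shows "dist x z = sqrt (r\<^sup>2 * r\<^sup>2 - ((2 * r\<^sup>2 - s\<^sup>2) / 2)\<^sup>2) * 2 / r"
proof -
  define m where "m = (2 * r\<^sup>2 - s\<^sup>2) / 2"
  have r: "0 < r"
    using assms by (metis norm_eq_zero norm_ge_zero order_le_less)
  have inner: "y \<bullet> x = m" "y \<bullet> z = m"
    using assms by (simp_all add: m_def dot_norm_neg dist_norm norm_minus_commute)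
  have c: "(cross2 y x)\<^sup>2 = r\<^sup>2 * r\<^sup>2 - m\<^sup>2" "(cross2 y z)\<^sup>2 = r\<^sup>2 * r\<^sup>2 - m\<^sup>2"
    using cross2_inner_expand[of y x x] cross2_inner_expand[of y z z] inner assms(1-3)
    by (simp_all add: power2_norm_eq_inner[symmetric] inner_commute power2_eq_square)
  have *: "r\<^sup>2 * (norm (x - z))\<^sup>2 = (cross2 y x - cross2 y z)\<^sup>2"
    using cross2_inner_expand[of y "x - z" "x - z"] inner assms(2)
    by (simp add: power2_norm_eq_inner[symmetric] inner_diff inner_commute cross2_alt
        power2_eq_square algebra_simps)
  then have "cross2 y x \<noteq> cross2 y z"
    using assms(6) r by auto
  \<comment> \<open>The two cross products have the same square; since \<open>x\<close> and
    \<open>z\<close> differ, they are opposite.\<close>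
  moreover have "cross2 y x = cross2 y z \<or> cross2 y x = - cross2 y z"
    using c by (simp add: power2_eq_iff[symmetric])
  ultimately have "r\<^sup>2 * (norm (x - z))\<^sup>2 = 4 * (r\<^sup>2 * r\<^sup>2 - m\<^sup>2)"
    using * c by (simp add: power2_eq_square algebra_simps)
  then have "(norm (x - z) * r / 2)\<^sup>2 = r\<^sup>2 * r\<^sup>2 - m\<^sup>2"
    by (simp add: power_mult_distrib power_divide mult.commute)
  then have "norm (x - z) * r / 2 = sqrt (r\<^sup>2 * r\<^sup>2 - m\<^sup>2)"
    using r by (metis abs_of_nonneg divide_nonneg_nonneg less_imp_le mult_nonneg_nonneg
        norm_ge_zero real_sqrt_abs zero_le_numeral)
  then show ?thesis
    using r by (simp add: dist_norm m_def field_simps)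
qed

lemma equal_short_diagonals_triple:
  assumes V: "convex_polygon n V" and k: "1 < k" "n = 3 * k"
    and eq: "equilateral V" "equal_diagonals k V"
  shows "equal_diagonals 2 V"
proof -
  have simple: "simple_polygon n V" and per: "\<And>i. V (i + int n) = V i"
    using V by (auto simp: convex_polygon_def simple_polygon_def closed_polygon_def)
  have per3: "V (i + 3 * int k) = V i" for i
    using per[of i] by (simp add: k)
  obtain s where s: "\<And>i. dist (V i) (V (i + 1)) = s"
    using eq(1) by (auto simp: equilateral_def)
  obtain d where d: "\<And>i. dist (V i) (V (i + int k)) = d"
    using eq(2) by (auto simp: equal_diagonals_def)
  obtain \<sigma> :: real where \<sigma>: "\<sigma> = 1 \<or> \<sigma> = -1"
    "\<And>i j l. i < j \<Longrightarrow> j < l \<Longrightarrow> l < i + int n \<Longrightarrow> 0 \<le> \<sigma> * cross2 (V j - V i) (V l - V j)"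
    using convex_polygon_oriented[OF V] by blast
  \<comment> \<open>Since \<open>n = 3 * k\<close>, this is a \<open>k\<close>-diagonal traversed
    backwards.\<close>
  have "dist (V i) (V (i + int (2 * k))) = d" for i
    using d[of "i + 2 * int k"] per3[of i] by (simp add: dist_commute add.assoc)
  then have "equal_diagonals (2 * k) V"
    by (auto simp: equal_diagonals_def)
  then obtain Z where Z: "\<And>i. V (i + 2 * int k) - V (i + int k) = Z * (V (i + int k) - V i)"
    using diagonal_rotation[OF V _ _ eq(2)] k by auto
  have nz: "V (i + int k) - V i \<noteq> 0" for i
    using simple_polygon_vertices_distinct[OF simple, of "int k" i] k by simp
  have Z0: "Z\<^sup>2 + Z + 1 = 0"
  proof -
    define a where "a = V (int k) - V 0"
    have 1: "V (2 * int k) - V (int k) = Z * a"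
      using Z[of 0] by (simp add: a_def)
    have "V 0 - V (2 * int k) = Z * (Z * a)"
      using Z[of "int k"] per3[of 0] unfolding 1[symmetric] by simp
    moreover have "a + (V (2 * int k) - V (int k)) + (V 0 - V (2 * int k)) = 0"
      by (simp add: a_def)
    ultimately have "a + Z * a + Z * (Z * a) = 0"
      by (simp only: 1)
    then have "(Z\<^sup>2 + Z + 1) * (V (0 + int k) - V 0) = 0"
      unfolding a_def by (simp add: power2_eq_square algebra_simps)
    then show ?thesis
      using nz[of 0] by simp
  qed
  define F where "F i = V (i + 1) - V i" for i
  have normF: "norm (F i) = s" for i
    using s[of i] by (simp add: F_def dist_norm norm_minus_commute)
  have F0: "F i \<noteq> 0" for i
    using simple_polygon_vertices_distinct[OF simple, of 1 i] k by (simp add: F_def)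
  have ZF: "F (i + 2 * int k) - F (i + int k) = Z * (F (i + int k) - F i)" for i
  proof -
    have "F (i + 2 * int k) - F (i + int k) =
        (V (i + 1 + 2 * int k) - V (i + 1 + int k)) - (V (i + 2 * int k) - V (i + int k))"
      by (simp add: F_def algebra_simps)
    also have "\<dots> = Z * (V (i + 1 + int k) - V (i + 1)) - Z * (V (i + int k) - V i)"
      by (simp only: Z)
    finally show ?thesis
      by (simp add: F_def algebra_simps)
  qed
  \<comment> \<open>Parallel supporting lines with the same inner normal coincide.\<close>
  have collinear: "cross2 (F i) (V (i + int k) - V i) = 0" if "F (i + int k) = F i" for i
  proof -
    have "cross2 (F i) (V (i + int k) - V (i + 1)) = cross2 (F i) (V (i + int k) - V i)"
      by (simp add: F_def cross2_alt algebra_simps)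
    then have 1: "0 \<le> \<sigma> * cross2 (F i) (V (i + int k) - V i)"
      using \<sigma>(2)[of i "i + 1" "i + int k"] k by (simp add: F_def)
    have next_vertex: "V (i + int k + 1) = V (i + int k) + F i"
      using that by (simp add: F_def algebra_simps)
    have "0 \<le> \<sigma> * cross2 (V (i + int k + 1) - V (i + int k)) (V (i + int n) - V (i + int k + 1))"
      using k by (intro \<sigma>(2)) auto
    then have "0 \<le> \<sigma> * cross2 (F i) (V i - V (i + int k) - F i)"
      unfolding per next_vertex by (simp add: diff_diff_eq)
    then have "0 \<le> \<sigma> * - cross2 (F i) (V (i + int k) - V i)"
      by (simp add: cross2_alt algebra_simps)
    with 1 show ?thesis
      using \<sigma>(1) by auto
  qed
  \<comment> \<open>If two of the three side vectors agreed, so would the third. Then a diagonal and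
    its product with the non-real \<open>Z\<close> would both be parallel to
    \<open>F i\<close>.\<close>
  have g: "F (i + int k) - F i \<noteq> 0" for i
  proof
    assume 0: "F (i + int k) - F i = 0"
    then have F1: "F (i + int k) = F i" "F (i + int k + int k) = F (i + int k)"
      using ZF[of i] by (simp_all add: algebra_simps)
    define w where "w = cnj (F i) * (V (i + int k) - V i)"
    have "Im w = 0"
      using collinear[OF F1(1)] by (simp add: w_def cross2_def)
    moreover have "Im (Z * w) = 0"
    proof -
      have "cross2 (F i) (Z * (V (i + int k) - V i)) = 0"
        using collinear[OF F1(2)] unfolding F1(1) Z[of i, symmetric] by (simp add: add.assoc)
      then show ?thesis
        by (simp only: w_def cross2_def mult.left_commute)
    qed
    ultimately have "w = 0"
      using primitive_cube_root(2)[OF Z0] by (simp add: complex_eq_iff)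
    then show False
      using F0[of i] nz[of i] by (simp add: w_def)
  qed
  \<comment> \<open>Three times the centre of the triangle; its increment from \<open>i\<close> to
    \<open>i + 1\<close> is the sum of three side vectors.\<close>
  define c where "c i = V i + V (i + int k) + V (i + 2 * int k)" for i
  have "c (i + 1) = c i" for i
  proof -
    define g where "g = F (i + int k) - F i"
    have 1: "F (i + int k) = F i + g" "F (i + 2 * int k) = F i + g + Z * g"
      using ZF[of i] by (simp_all add: g_def algebra_simps)
    have "norm (F i + g) = norm (F i)" "norm (F i + g + Z * g) = norm (F i)" "g \<noteq> 0"
      using normF 1 g[of i] by (metis, metis, simp add: g_def)
    then have "3 * F i + 2 * g + Z * g = 0"
      by (intro equilateral_triangle_centre Z0)
    then have "F i + F (i + int k) + F (i + 2 * int k) = 0"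
      unfolding 1 by (simp add: algebra_simps)
    then show ?thesis
      by (simp add: c_def F_def algebra_simps)
  qed
  then have c: "c i = c 0" for i
    by (rule int_const_if_step)
  \<comment> \<open>The polygon scaled by 3 and moved so that the common centre is the origin; all
    its vertices lie on one circle around it.\<close>
  define P where "P i = 3 * V i - c 0" for i
  have normP: "norm (P i) = norm (2 + Z) * d" for i
  proof -
    have 1: "V (i + 2 * int k) = V (i + int k) + Z * (V (i + int k) - V i)"
      using Z[of i] by (simp add: algebra_simps)
    have 2: "P i = 3 * V i - c i"
      by (simp only: P_def c[of i])
    have "P i = - ((2 + Z) * (V (i + int k) - V i))"
      unfolding 2 c_def 1 by (simp add: algebra_simps)
    then show ?thesis
      using d[of i] by (simp add: norm_mult dist_norm norm_minus_commute)
  qed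
  have distP: "dist (P i) (P j) = 3 * dist (V i) (V j)" for i j
  proof -
    have "P i - P j = 3 * (V i - V j)"
      by (simp add: P_def algebra_simps)
    then show ?thesis
      by (simp only: dist_norm norm_mult norm_numeral)
  qed
  define r where "r = norm (2 + Z) * d"
  have "dist (P i) (P (i + 2)) = sqrt (r\<^sup>2 * r\<^sup>2 - ((2 * r\<^sup>2 - (3 * s)\<^sup>2) / 2)\<^sup>2) * 2 / r" for i
  proof (rule dist_on_circle[where y = "P (i + 1)"])
    show "dist (P i) (P (i + 1)) = 3 * s" "dist (P (i + 1)) (P (i + 2)) = 3 * s"
      using s[of i] s[of "i + 1"] by (simp_all add: distP add.assoc)
    show "P i \<noteq> P (i + 2)"
      using simple_polygon_vertices_distinct[OF simple, of 2 i] k by (simp add: P_def)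
  qed (simp_all add: normP r_def)
  then obtain q where "\<And>i. dist (P i) (P (i + 2)) = q"
    by blast
  then have "dist (V i) (V (i + 2)) = q / 3" for i
    by (metis distP nonzero_mult_div_cancel_left zero_neq_numeral)
  then show ?thesis
    unfolding equal_diagonals_def of_nat_numeral by blast
qed

theorem theorem9:
  fixes n k :: nat and V :: "int \<Rightarrow> complex"
  assumes "2 \<le> k" and "2 * k \<le> n"
    and "convex_polygon n V"
    and "bicycle_polygon n k V"
    and "k = 2 \<or> (odd n \<and> k = 3) \<or> n = 2 * k + 1 \<or> n = 3 * k"
  shows "regular_polygon n V"
proof -
  have eq: "equilateral V" "equal_diagonals k V"
    using assms(4) by (auto simp: bicycle_polygon_def)
  have "equal_diagonals 2 V"
    using assms(5)
  proof (elim disjE conjE)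
    assume "odd n" "k = 3"
    then show ?thesis
      using equal_short_diagonals_3 assms(2,3) eq by simp
  next
    assume "n = 2 * k + 1"
    then show ?thesis
      using equal_short_diagonals_Suc_double assms(1,3) eq by simp
  next
    assume "n = 3 * k"
    then show ?thesis
      using equal_short_diagonals_triple assms(1,3) eq by simp
  qed (use eq in simp)
  then show ?thesis
    using equiangular_if_equal_short_diagonals eq assms(3) by (simp add: regular_polygon_def)
qed

end
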